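(* Let $k\ge 1$ and $n\ge 3$ be integers such that $k$ is odd and $n$ is even. Then there is no degenerated magic polygon $D(n,k)$.
   Context: Degenerated magic polygon $D(n,k)$: take $k$ regular $n$-gons of distinct sizes sharing a common vertex $C$ (the root vertex), nested so that they are homothetic with center $C$. On each of the $n-2$ edges of each polygon not adjacent to $C$ there are $k-1$ intermediate points besides the two end vertices. Thus the $t$-th polygon ($1\le t\le k$) carries, besides $C$, the points $P_{t,m}$, $1\le m\le k(n-2)+1$, listed clockwise; the vertices other than $C$ are those with $m\equiv1\pmod k$, i.e. $m=1,k+1,\dots,k(n-2)+1$, and the $i$-th edge not adjacent to $C$ ($1\le i\le n-2$) consists of the $k+1$ points $P_{t,(i-1)k+1},\dots,P_{t,ik+1}$. Points with the same $m$ lie on a common segment from $C$. Together with $C$ there are $k^2(n-2)+k+1$ points. They are labeled bijectively by $1,2,\dots,k^2(n-2)+k+1$; let $x_{t,m}$ be the label of $P_{t,m}$ and $c$ the label of $C$. The labeled configuration is a degenerated magic polygon $D(n,k)$ if there is a fixed value $u$ (the magic sum) such that: (a) for all $1\le t\le k$ and $1\le i\le n-2$, $\sum_{s=1}^{k+1}x_{t,(i-1)k+s}=u$; (b) for all $1\le m\le k(n-2)+1$, $\sum_{t=1}^{k}x_{t,m}+c=u$. *)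

theory Defs
  imports Complex_Main
begin

text \<open>Only the incidence structure of the nested polygons enters the magic conditions:
  \<open>Pt t m\<close> is the \<open>m\<close>-th point (clockwise) of the \<open>t\<close>-th polygon other than the common
  vertex \<open>Root\<close>.\<close>

datatype point = Root | Pt nat nat

definition polygon_points :: "nat \<Rightarrow> nat \<Rightarrow> point set" where
  "polygon_points n k = insert Root {Pt t m | t m. t \<in> {1..k} \<and> m \<in> {1..k * (n - 2) + 1}}"

definition is_degenerated_magic_polygon :: "nat \<Rightarrow> nat \<Rightarrow> (point \<Rightarrow> nat) \<Rightarrow> bool" where
  "is_degenerated_magic_polygon n k x \<longleftrightarrow>
     bij_betw x (polygon_points n k) {1..k\<^sup>2 * (n - 2) + k + 1} \<and>
     (\<exists>u. (\<forall>t\<in>{1..k}. \<forall>i\<in>{1..n - 2}. (\<Sum>s=1..k + 1. x (Pt t ((i - 1) * k + s))) = u) \<and>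
          (\<forall>m\<in>{1..k * (n - 2) + 1}. (\<Sum>t=1..k. x (Pt t m)) + x Root = u))"

end

theory Submission
  imports Defs
begin

text \<open>
  The magic conditions determine the label \<open>c\<close> of the common vertex: it must be the mean of all
  labels. Let \<open>M = k(n - 2) + 1\<close> be the number of segments from the common vertex, so that there
  are \<open>kM + 1\<close> points. Take one edge position and add up its \<open>k\<close> edge sums, one for each polygon.
  The points concerned fill \<open>k + 1\<close> complete segments, each with label sum \<open>u - c\<close> away from the
  common vertex, so \<open>ku = (k + 1)(u - c)\<close>, that is \<open>u = (k + 1)c\<close>. Every segment then has
  sum \<open>kc\<close> away from the common vertex, and all labels together have sum \<open>c + Mkc = (kM + 1)c\<close>.
  Since the labels are \<open>1, \<dots>, kM + 1\<close>, this gives \<open>2c = kM + 2\<close>. If \<open>k\<close> is odd and \<open>n\<close> is even,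
  then \<open>M\<close> is odd as well, and \<open>kM + 2\<close> cannot be even.
\<close>

lemma sum_polygon_points:
  fixes x :: "point \<Rightarrow> nat"
  shows "(\<Sum>p\<in>polygon_points n k. x p)
    = x Root + (\<Sum>m=1..k * (n - 2) + 1. \<Sum>t=1..k. x (Pt t m))"
proof -
  let ?A = "{1..k} \<times> {1..k * (n - 2) + 1}"
  have points: "polygon_points n k = insert Root ((\<lambda>(t, m). Pt t m) ` ?A)"
    by (auto simp: polygon_points_def)
  have "(\<Sum>p\<in>polygon_points n k. x p) = x Root + (\<Sum>p\<in>(\<lambda>(t, m). Pt t m) ` ?A. x p)"
    unfolding points by (subst sum.insert) auto
  also have "(\<Sum>p\<in>(\<lambda>(t, m). Pt t m) ` ?A. x p) = (\<Sum>(t, m)\<in>?A. x (Pt t m))"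
    by (subst sum.reindex) (auto simp: inj_on_def intro!: sum.cong)
  also have "\<dots> = (\<Sum>t=1..k. \<Sum>m=1..k * (n - 2) + 1. x (Pt t m))"
    by (rule sum.cartesian_product [symmetric])
  also have "\<dots> = (\<Sum>m=1..k * (n - 2) + 1. \<Sum>t=1..k. x (Pt t m))"
    by (rule sum.swap)
  finally show ?thesis .
qed

text \<open>Counting the first edge of every polygon in two ways, by polygons and by segments from the
  common vertex, leaves a linear equation between the magic sum and the root label.\<close>

lemma magic_sum_eq_root_label:
  fixes x :: "point \<Rightarrow> nat"
  assumes "n \<ge> 3"
    and edges: "\<forall>t\<in>{1..k}. \<forall>i\<in>{1..n - 2}. (\<Sum>s=1..k + 1. x (Pt t ((i - 1) * k + s))) = u"
    and segments: "\<forall>m\<in>{1..k * (n - 2) + 1}. (\<Sum>t=1..k. x (Pt t m)) + x Root = u"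
  shows "u = (k + 1) * x Root"
proof -
  have first_edge: "(\<Sum>s=1..k + 1. x (Pt t s)) = u" if "t \<in> {1..k}" for t
    using edges[rule_format, of t 1] that \<open>n \<ge> 3\<close> by simp
  have "1 \<le> n - 2"
    using \<open>n \<ge> 3\<close> by linarith
  then have "{1..k + 1} \<subseteq> {1..k * (n - 2) + 1}"
    by simp
  then have segment: "(\<Sum>t=1..k. x (Pt t s)) + x Root = u" if "s \<in> {1..k + 1}" for s
    using segments that by blast
  have "k * u = (\<Sum>t=1..k. \<Sum>s=1..k + 1. x (Pt t s))"
    using first_edge by simp
  also have "\<dots> = (\<Sum>s=1..k + 1. \<Sum>t=1..k. x (Pt t s))"
    by (rule sum.swap)
  finally have "k * u + (k + 1) * x Root = (\<Sum>s=1..k + 1. (\<Sum>t=1..k. x (Pt t s)) + x Root)"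
    by (simp add: sum.distrib)
  also have "\<dots> = (k + 1) * u"
    using segment by simp
  finally show ?thesis
    by simp
qed

text \<open>Since \<open>k(k(n - 2) + 1) + 1\<close> is the number of points, the root label is the mean of all
  labels.\<close>

lemma root_label_degenerated_magic_polygon:
  assumes "n \<ge> 3" and "is_degenerated_magic_polygon n k x"
  shows "2 * x Root = k * (k * (n - 2) + 1) + 2"
proof -
  define M where "M = k * (n - 2) + 1"
  have card: "k\<^sup>2 * (n - 2) + k + 1 = k * M + 1"
    by (simp add: M_def power2_eq_square algebra_simps)
  obtain u where bij: "bij_betw x (polygon_points n k) {1..k * M + 1}"
    and edges: "\<forall>t\<in>{1..k}. \<forall>i\<in>{1..n - 2}. (\<Sum>s=1..k + 1. x (Pt t ((i - 1) * k + s))) = u"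
    and segments: "\<forall>m\<in>{1..M}. (\<Sum>t=1..k. x (Pt t m)) + x Root = u"
    using assms(2) unfolding is_degenerated_magic_polygon_def card by (auto simp: M_def)
  have "u = (k + 1) * x Root"
    using magic_sum_eq_root_label[OF assms(1) edges] segments by (simp add: M_def)
  then have segment: "(\<Sum>t=1..k. x (Pt t m)) = k * x Root" if "m \<in> {1..M}" for m
    using bspec[OF segments that] by simp
  have "\<Sum>{1..k * M + 1} = (\<Sum>p\<in>polygon_points n k. x p)"
    using sum.reindex_bij_betw[OF bij, of "\<lambda>l. l"] by simp
  also have "\<dots> = x Root + (\<Sum>m=1..M. \<Sum>t=1..k. x (Pt t m))"
    unfolding M_def by (rule sum_polygon_points)
  also have "\<dots> = x Root + M * (k * x Root)"
    using segment by simp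
  also have "\<dots> = (k * M + 1) * x Root"
    by (simp add: algebra_simps)
  finally have sum_labels: "\<Sum>{1..k * M + 1} = (k * M + 1) * x Root" .
  have "2 * \<Sum>{1..N} = N * (N + 1)" for N :: nat
    by (induction N) auto
  from this[of "k * M + 1"] have "(k * M + 1) * (2 * x Root) = (k * M + 1) * (k * M + 2)"
    unfolding sum_labels by simp
  then show ?thesis
    unfolding M_def[symmetric] by (subst (asm) mult_cancel1) simp
qed

theorem corollary2:
  fixes n k :: nat
  assumes "k \<ge> 1" and "n \<ge> 3" and "odd k" and "even n"
  shows "\<not> (\<exists>x. is_degenerated_magic_polygon n k x)"
proof
  assume "\<exists>x. is_degenerated_magic_polygon n k x"
  then obtain x where "is_degenerated_magic_polygon n k x" ..
  with \<open>n \<ge> 3\<close> have "2 * x Root = k * (k * (n - 2) + 1) + 2"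
    by (rule root_label_degenerated_magic_polygon)
  then have "even (k * (k * (n - 2) + 1) + 2)"
    by (metis dvd_triv_left)
  with \<open>odd k\<close> \<open>even n\<close> show False
    by simp
qed

end
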